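(* Let $k\ge 2$ experts and a decision maker be in the conjugate-pair information structure described in the context. Assume only private information is available to the experts, i.e. $n_i>0$ for $i=1,\dots,k$ and $n_s=0$, and assume the predictive generating function $F_n(t)$ is strictly monotonic in $t$. Then the Bayesian ensemble of the experts' probabilities is the generalized additive model $$\hat p = P(y=1\mid p_1,\dots,p_k)=F_{N_k}\Big(-(k-1)F_0^{-1}(p_0)+\sum_{i=1}^k F_{n_i}^{-1}(p_i)\Big),$$ where $p_0=F_0(\tau_1)$, $p_i=F_{n_i}(\tau_1+t_i)$, and $t_i=\sum_{j=N_{i-1}+1}^{N_i}h(x_j)$. Also, the Bayesian ensemble of the experts' sufficient statistics is the generalized linear model $$P(y=1\mid t_1,\dots,t_k)=F_{N_k}\Big(\tau_1+\sum_{i=1}^k t_i\Big).$$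
   Context: Information structure. There is a real parameter $\theta$ and a sequence of data points $x_1,\dots,x_{N_k+n_s},x_{N_k+n_s+1}$ which, given $\theta$, are independent and identically distributed according to a regular one-parameter exponential family with probability mass or density function $f(x_j\mid\theta)=a(x_j)\,b(\theta)\exp(c(\theta)h(x_j))$. The parameter $\theta$ has the conjugate prior $f(\theta)=[K(\tau_0,\tau_1)]^{-1}[b(\theta)]^{\tau_0}\exp(c(\theta)\tau_1)$, with hyperparameters $\tau_0,\tau_1$ and normalizing constant $K(\tau_0,\tau_1)=\int [b(\theta)]^{\tau_0}\exp(c(\theta)\tau_1)\,d\theta$ (finite). Sample sizes: $n_1,\dots,n_k,n_s$, with $N_i=\sum_{l=1}^i n_l$, $N_0=0$. Expert $i$ observes the private sample $\boldsymbol x_i=(x_{N_{i-1}+1},\dots,x_{N_i})$ of size $n_i$; all experts (but not the decision maker) observe the shared sample $\boldsymbol x_s=(x_{N_k+1},\dots,x_{N_k+n_s})$ of size $n_s$ (empty when $n_s=0$). The last data point $x:=x_{N_k+n_s+1}$ is observed by nobody; $A$ is a fixed event-occurrence set, and $y=1$ if $x\in A$, $y=0$ otherwise. The joint distribution of all these quantities, all sample sizes and the set $A$ are common knowledge. Forecasts. The prior-predictive probability is $p_0=P(y=1)$. Expert $i$ reports $p_i=P(y=1\mid\boldsymbol x_i,\boldsymbol x_s)$ (when $n_s=0$: $p_i=P(y=1\mid\boldsymbol x_i)$). The decision maker's Bayesian ensemble is the posterior-predictive probability $\hat p=P(y=1\mid p_1,\dots,p_k)$ derived from the joint distribution of $(p_1,\dots,p_k,y)$.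 Predictive generating function. For a sample size $n\geq 0$ and real $t$ (in the range where the expressions are defined), $$F_n(t)=\int_{x\in A}a(x)\frac{K(\tau_0+n+1,\,t+h(x))}{K(\tau_0+n,\,t)}\,dx,$$ with the integral replaced by a sum if the data are discrete. $F_n^{-1}$ denotes its inverse, as a function of $t$ for fixed $n$. A generalized additive model for $y$ in covariates $q_1,\dots,q_k$ is an expression $E[y\mid q_1,\dots,q_k]=g^{-1}(g_0+g_1(q_1)+\cdots+g_k(q_k))$ with link function $g$, constant $g_0$ and (smooth) functions $g_i$; "smooth" is used in the informal statistical sense, with no specific differentiability class intended. A generalized linear model is one in which each $g_i$ is a linear function. *)

theory Defs
  imports "HOL-Probability.Probability"
begin

(* Densities are taken with respect to a sigma-finite base measure: lborel for densities,
   count_space S with S countable for mass functions (integrals are then sums).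
   Regularity (the support does not depend on the parameter) is built into the factorised
   form, whose positivity set {x. 0 < a x} is the same for every parameter in ef_Theta. *)
record 'x exp_family =
  ef_base :: "'x measure"
  ef_Theta :: "real set"
  ef_a :: "'x \<Rightarrow> real"
  ef_b :: "real \<Rightarrow> real"
  ef_c :: "real \<Rightarrow> real"
  ef_h :: "'x \<Rightarrow> real"

definition ef_density :: "'x exp_family \<Rightarrow> real \<Rightarrow> 'x \<Rightarrow> real" where
  "ef_density E \<theta> x = ef_a E x * ef_b E \<theta> * exp (ef_c E \<theta> * ef_h E x)"

definition exponential_family :: "'x exp_family \<Rightarrow> bool" where
  "exponential_family E \<longleftrightarrow>
     sigma_finite_measure (ef_base E) \<and>
     ef_Theta E \<in> sets borel \<and>
     ef_a E \<in> borel_measurable (ef_base E) \<and>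
     ef_h E \<in> borel_measurable (ef_base E) \<and>
     ef_b E \<in> borel_measurable borel \<and>
     ef_c E \<in> borel_measurable borel \<and>
     (\<forall>x\<in>space (ef_base E). 0 \<le> ef_a E x) \<and>
     (\<forall>\<theta>\<in>ef_Theta E. 0 < ef_b E \<theta>) \<and>
     (\<forall>\<theta>\<in>ef_Theta E. (\<integral>\<^sup>+x. ennreal (ef_density E \<theta> x) \<partial>ef_base E) = 1)"

definition conj_kernel :: "'x exp_family \<Rightarrow> real \<Rightarrow> real \<Rightarrow> real \<Rightarrow> real" where
  "conj_kernel E \<tau>0 \<tau>1 \<theta> = ef_b E \<theta> powr \<tau>0 * exp (ef_c E \<theta> * \<tau>1)"

definition conj_K_finite :: "'x exp_family \<Rightarrow> real \<Rightarrow> real \<Rightarrow> bool" where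
  "conj_K_finite E \<tau>0 \<tau>1 \<longleftrightarrow> set_integrable lborel (ef_Theta E) (conj_kernel E \<tau>0 \<tau>1)"

definition conj_K :: "'x exp_family \<Rightarrow> real \<Rightarrow> real \<Rightarrow> real" where
  "conj_K E \<tau>0 \<tau>1 = (LINT \<theta>:ef_Theta E|lborel. conj_kernel E \<tau>0 \<tau>1 \<theta>)"

definition conj_prior :: "'x exp_family \<Rightarrow> real \<Rightarrow> real \<Rightarrow> real \<Rightarrow> real" where
  "conj_prior E \<tau>0 \<tau>1 \<theta> =
     indicat_real (ef_Theta E) \<theta> * (conj_kernel E \<tau>0 \<tau>1 \<theta> / conj_K E \<tau>0 \<tau>1)"

definition cum_size :: "(nat \<Rightarrow> nat) \<Rightarrow> nat \<Rightarrow> nat" where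
  "cum_size n i = (\<Sum>l=1..i. n l)"

definition private_idx :: "(nat \<Rightarrow> nat) \<Rightarrow> nat \<Rightarrow> nat set" where
  "private_idx n i = {cum_size n (i - 1) + 1..cum_size n i}"

definition shared_idx :: "(nat \<Rightarrow> nat) \<Rightarrow> nat \<Rightarrow> nat \<Rightarrow> nat set" where
  "shared_idx n k ns = {cum_size n k + 1..cum_size n k + ns}"

definition last_idx :: "(nat \<Rightarrow> nat) \<Rightarrow> nat \<Rightarrow> nat \<Rightarrow> nat" where
  "last_idx n k ns = cum_size n k + ns + 1"

(* The last conjunct gives the joint law: the parameter has the conjugate prior and, given the
   parameter, the data points are iid from the exponential family. *)
definition conjugate_pair_structure ::
    "'w measure \<Rightarrow> 'x exp_family \<Rightarrow> real \<Rightarrow> real \<Rightarrow> (nat \<Rightarrow> nat) \<Rightarrow> nat \<Rightarrow> nat \<Rightarrow> 'x set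
      \<Rightarrow> ('w \<Rightarrow> real) \<Rightarrow> (nat \<Rightarrow> 'w \<Rightarrow> 'x) \<Rightarrow> bool" where
  "conjugate_pair_structure M E \<tau>0 \<tau>1 n k ns A \<Theta> X \<longleftrightarrow>
     prob_space M \<and>
     exponential_family E \<and>
     conj_K_finite E \<tau>0 \<tau>1 \<and>
     A \<in> sets (ef_base E) \<and>
     distributed M
       (lborel \<Otimes>\<^sub>M (\<Pi>\<^sub>M j\<in>{1..last_idx n k ns}. ef_base E))
       (\<lambda>\<omega>. (\<Theta> \<omega>, \<lambda>j\<in>{1..last_idx n k ns}. X j \<omega>))
       (\<lambda>(\<theta>, x). ennreal (conj_prior E \<tau>0 \<tau>1 \<theta> *
                    (\<Prod>j\<in>{1..last_idx n k ns}. ef_density E \<theta> (x j))))"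

definition outcome ::
    "(nat \<Rightarrow> nat) \<Rightarrow> nat \<Rightarrow> nat \<Rightarrow> 'x set \<Rightarrow> (nat \<Rightarrow> 'w \<Rightarrow> 'x) \<Rightarrow> 'w \<Rightarrow> real" where
  "outcome n k ns A X \<omega> = (if X (last_idx n k ns) \<omega> \<in> A then 1 else 0)"

definition sigma_gen ::
    "'w measure \<Rightarrow> 'b measure \<Rightarrow> nat set \<Rightarrow> (nat \<Rightarrow> 'w \<Rightarrow> 'b) \<Rightarrow> 'w measure" where
  "sigma_gen M N I Z = vimage_algebra (space M) (\<lambda>\<omega>. \<lambda>i\<in>I. Z i \<omega>) (\<Pi>\<^sub>M i\<in>I. N)"

(* P(y = 1 | G), a version of the conditional probability, unique up to almost-sure equality *)
definition cond_prob_one :: "'w measure \<Rightarrow> ('w \<Rightarrow> real) \<Rightarrow> 'w measure \<Rightarrow> 'w \<Rightarrow> real" where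
  "cond_prob_one M y G = real_cond_exp M G (indicat_real {\<omega>\<in>space M. y \<omega> = 1})"

definition forecast ::
    "'w measure \<Rightarrow> 'x exp_family \<Rightarrow> (nat \<Rightarrow> nat) \<Rightarrow> nat \<Rightarrow> nat \<Rightarrow> 'x set
      \<Rightarrow> (nat \<Rightarrow> 'w \<Rightarrow> 'x) \<Rightarrow> nat \<Rightarrow> 'w \<Rightarrow> real" where
  "forecast M E n k ns A X i =
     cond_prob_one M (outcome n k ns A X)
       (sigma_gen M (ef_base E) (private_idx n i \<union> shared_idx n k ns) X)"

definition suff_stat ::
    "'x exp_family \<Rightarrow> (nat \<Rightarrow> nat) \<Rightarrow> (nat \<Rightarrow> 'w \<Rightarrow> 'x) \<Rightarrow> nat \<Rightarrow> 'w \<Rightarrow> real" where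
  "suff_stat E n X i \<omega> = (\<Sum>j\<in>private_idx n i. ef_h E (X j \<omega>))"

(* The range of t in which F_n(t) is defined. Finiteness of K(tau0 + n, t) is enough: by Tonelli,
   the integral of a(x) K(tau0 + n + 1, t + h(x)) over the whole data space equals
   K(tau0 + n, t), so the numerator is finite for almost every x with a(x) > 0. *)
definition pgf_dom :: "'x exp_family \<Rightarrow> real \<Rightarrow> nat \<Rightarrow> real set" where
  "pgf_dom E \<tau>0 n = {t. conj_K_finite E (\<tau>0 + real n) t}"

definition pred_gen_fun :: "'x exp_family \<Rightarrow> real \<Rightarrow> 'x set \<Rightarrow> nat \<Rightarrow> real \<Rightarrow> real" where
  "pred_gen_fun E \<tau>0 A n t =
     (LINT x:A|ef_base E. ef_a E x *
        (conj_K E (\<tau>0 + real n + 1) (t + ef_h E x) / conj_K E (\<tau>0 + real n) t))"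

definition pred_gen_inv :: "'x exp_family \<Rightarrow> real \<Rightarrow> 'x set \<Rightarrow> nat \<Rightarrow> real \<Rightarrow> real" where
  "pred_gen_inv E \<tau>0 A n = inv_into (pgf_dom E \<tau>0 n) (pred_gen_fun E \<tau>0 A n)"

(* E[y | q_i, i in I] = ginv (g0 + sum of g_i(q_i)). The link enters through its inverse ginv,
   which has to be injective on a set D containing the additive predictor almost surely, so that
   the link is the inverse of ginv on ginv ` D. No smoothness class is imposed on the g_i. *)
definition generalized_additive_model ::
    "'w measure \<Rightarrow> ('w \<Rightarrow> real) \<Rightarrow> nat set \<Rightarrow> (nat \<Rightarrow> 'w \<Rightarrow> real)
      \<Rightarrow> real set \<Rightarrow> (real \<Rightarrow> real) \<Rightarrow> real \<Rightarrow> (nat \<Rightarrow> real \<Rightarrow> real) \<Rightarrow> bool" where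
  "generalized_additive_model M y I q D ginv g0 g \<longleftrightarrow>
     inj_on ginv D \<and>
     (\<forall>i\<in>I. q i \<in> borel_measurable M) \<and>
     (AE \<omega> in M. g0 + (\<Sum>i\<in>I. g i (q i \<omega>)) \<in> D \<and>
        real_cond_exp M (sigma_gen M borel I q) y \<omega> = ginv (g0 + (\<Sum>i\<in>I. g i (q i \<omega>))))"

definition generalized_linear_model ::
    "'w measure \<Rightarrow> ('w \<Rightarrow> real) \<Rightarrow> nat set \<Rightarrow> (nat \<Rightarrow> 'w \<Rightarrow> real)
      \<Rightarrow> real set \<Rightarrow> (real \<Rightarrow> real) \<Rightarrow> real \<Rightarrow> (nat \<Rightarrow> real \<Rightarrow> real) \<Rightarrow> bool" where
  "generalized_linear_model M y I q D ginv g0 g \<longleftrightarrow>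
     generalized_additive_model M y I q D ginv g0 g \<and> (\<forall>i\<in>I. linear (g i))"

end

(* Conjugacy: integrating the parameter out, the marginal density of a subsample indexed by I is
   prod_I a(x_j) K(tau0 + |I|, tau1 + T) / K(tau0, tau1) with T = sum_I h(x_j). Dividing the densities
   of (x_I, x) and x_I gives P(y = 1 | x_I) = F_|I|(tau1 + T), so each forecast p_i determines
   tau1 + t_i because F_(n_i) is injective. The pooled predictive probability F_(N_k)(tau1 + sum t_i)
   is therefore already a function of (p_1, ..., p_k), and also of (t_1, ..., t_k), and by the tower
   property it equals the conditional probability given either of these coarser statistics. *)

theory Submission
  imports Defs
begin

section \<open>Measurable left inverses\<close>

text \<open>The image of \<open>D\<close> need not be Borel, so the inverse is extended monotonically to the
  convex hull of the image, an interval.\<close>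
lemma measurable_left_inverse_strict_mono_on:
  fixes f :: "real \<Rightarrow> real"
  assumes f: "monotone_on D (<) (<) f"
  shows "\<exists>g\<in>borel_measurable borel. \<forall>u\<in>D. g (f u) = u"
proof -
  have iff: "f u \<le> f v \<longleftrightarrow> u \<le> v" if "u \<in> D" "v \<in> D" for u v
    using f that by (metis less_eq_real_def linorder_not_less monotone_onD)
  define A where "A = {s. \<exists>u\<in>D. \<exists>v\<in>D. f u \<le> s \<and> s \<le> f v}"
  \<comment> \<open>On the image of \<open>D\<close> the supremum is a maximum and returns the
    preimage; elsewhere in \<open>A\<close> it fills the gaps without breaking monotonicity.\<close>
  define G where "G s = Sup {u \<in> D. f u \<le> s}" for s
  have G: "G (f u) = u" if "u \<in> D" for u
    unfolding G_def using that iff by (intro cSup_eq_maximum) auto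
  have "mono_on A G"
  proof (rule mono_onI)
    fix r s assume "r \<in> A" "s \<in> A" "r \<le> s"
    then obtain u v where uv: "u \<in> D" "f u \<le> r" "v \<in> D" "s \<le> f v"
      by (auto simp: A_def)
    \<comment> \<open>The bound \<open>v\<close> and the element \<open>u\<close> below
      \<open>r\<close> come from membership in \<open>A\<close>. They keep the larger set bounded
      and the smaller one nonempty, as comparing real suprema requires.\<close>
    have "bdd_above {u \<in> D. f u \<le> s}"
      using uv iff by (intro bdd_aboveI[of _ v]) force
    then show "G r \<le> G s"
      unfolding G_def using uv \<open>r \<le> s\<close> by (intro cSup_subset_mono) auto
  qed
  then have "G \<in> borel_measurable (restrict_space borel A)"
    by (rule borel_measurable_mono_on_fnc)
  moreover have "A \<in> sets borel"
    by (rule real_interval_borel_measurable) (force simp: is_interval_1 A_def)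
  ultimately have "(\<lambda>s. if s \<in> A then G s else 0) \<in> borel_measurable borel"
    by (subst (asm) measurable_restrict_space_iff[where c = 0]) auto
  then show ?thesis
    using G by (intro bexI[of _ "\<lambda>s. if s \<in> A then G s else 0"]) (auto simp: A_def)
qed

text \<open>A decreasing \<open>f\<close> becomes increasing after negation; the left inverse of
  \<open>- f\<close> is then precomposed with negation.\<close>

lemma measurable_left_inverse_strict_monotone:
  fixes f :: "real \<Rightarrow> real"
  assumes "monotone_on D (<) (<) f \<or> monotone_on D (<) (>) f"
  shows "\<exists>g\<in>borel_measurable borel. \<forall>u\<in>D. g (f u) = u"
proof (cases "monotone_on D (<) (<) f")
  case False
  with assms have "monotone_on D (<) (<) (\<lambda>u. - f u)"
    by (auto simp: monotone_on_def)
  from measurable_left_inverse_strict_mono_on[OF this] obtain g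
    where [measurable]: "g \<in> borel_measurable borel" and g: "\<forall>u\<in>D. g (- f u) = u" by auto
  have "(\<lambda>s. g (- s)) \<in> borel_measurable borel" by measurable
  with g show ?thesis by (intro bexI[of _ "\<lambda>s. g (- s)"]) auto
qed (rule measurable_left_inverse_strict_mono_on)

lemma inj_on_strict_monotone:
  fixes f :: "real \<Rightarrow> real"
  assumes "monotone_on D (<) (<) f \<or> monotone_on D (<) (>) f"
  shows "inj_on f D"
  using measurable_left_inverse_strict_monotone[OF assms] by (metis inj_onI)

section \<open>Generated sub-sigma-algebras\<close>

lemma space_sigma_gen [simp]: "space (sigma_gen M N I Z) = space M"
  by (simp add: sigma_gen_def)

text \<open>Minimality of the generated sigma-algebra. \<open>G\<close> may itself be a proper
  sub-sigma-algebra of \<open>M\<close>, so that statistics can be compared with the data they are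
  computed from.\<close>

lemma subalgebra_sigma_gen:
  assumes "space G = space M" "\<And>i. i \<in> I \<Longrightarrow> Z i \<in> measurable G N"
  shows "subalgebra G (sigma_gen M N I Z)"
proof -
  have "sets (sigma_gen M N I Z) \<subseteq> sets G"
    unfolding sigma_gen_def
    by (intro sets_image_in_sets measurable_restrict) (auto simp: assms)
  with assms(1) show ?thesis by (simp add: subalgebra_def)
qed

lemma measurable_sigma_gen:
  assumes "i \<in> I" "\<And>j. j \<in> I \<Longrightarrow> Z j \<in> space M \<rightarrow> space N"
  shows "Z i \<in> measurable (sigma_gen M N I Z) N"
proof -
  have "(\<lambda>\<omega>. \<lambda>j\<in>I. Z j \<omega>) \<in> measurable (sigma_gen M N I Z) (\<Pi>\<^sub>M j\<in>I. N)"
    unfolding sigma_gen_def using assms(2)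
    by (intro measurable_vimage_algebra1) (force simp: space_PiM)
  from measurable_compose[OF this measurable_component_singleton[OF assms(1)]] assms(1)
  show ?thesis by simp
qed

context prob_space
begin

text \<open>Tower property: conditioning \<open>f\<close> on \<open>G\<close> amounts to
  conditioning its \<open>H\<close>-version \<open>g\<close> on \<open>G\<close>, and
  \<open>g\<close> is already \<open>G\<close>-measurable. In the application \<open>H\<close> is
  the pooled data and \<open>G\<close> a coarser statistic.\<close>

lemma real_cond_exp_coarsen:
  assumes H: "subalgebra M H" and G: "subalgebra H G" and f: "integrable M f"
    and eq: "AE \<omega> in M. real_cond_exp M H f \<omega> = g \<omega>" and g: "g \<in> borel_measurable G"
  shows "AE \<omega> in M. real_cond_exp M G f \<omega> = g \<omega>"
proof -
  have MG: "subalgebra M G" using H G by (auto simp: subalgebra_def)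
  interpret H: finite_measure_subalgebra M H by standard (rule H)
  interpret G: finite_measure_subalgebra M G by standard (rule MG)
  have gM: "g \<in> borel_measurable M" using measurable_from_subalg[OF MG g] .
  have int: "integrable M g"
    using integrable_cong_AE[OF borel_measurable_cond_exp2 gM eq] H.real_cond_exp_int(1)[OF f] by blast
  have "AE \<omega> in M. real_cond_exp M G (real_cond_exp M H f) \<omega> = real_cond_exp M G f \<omega>"
    by (rule G.real_cond_exp_nested_subalg[OF H G f])
  moreover have "AE \<omega> in M. real_cond_exp M G (real_cond_exp M H f) \<omega> = real_cond_exp M G g \<omega>"
    by (rule G.real_cond_exp_cong[OF eq borel_measurable_cond_exp2 gM])
  moreover have "AE \<omega> in M. real_cond_exp M G g \<omega> = g \<omega>"
    by (rule G.real_cond_exp_F_meas[OF int g])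
  ultimately show ?thesis by eventually_elim simp
qed

end

section \<open>Exponential families and conjugate kernels\<close>

text \<open>The normalizing constant with values in the extended nonnegative reals: divergence shows
  as infinity, where the real-valued \<open>conj_K\<close> is 0, and Tonelli applies without
  integrability conditions.\<close>

definition nn_K :: "'x exp_family \<Rightarrow> real \<Rightarrow> real \<Rightarrow> ennreal" where
  "nn_K E s t = (\<integral>\<^sup>+\<theta>. indicator (ef_Theta E) \<theta> * ennreal (conj_kernel E s t \<theta>) \<partial>lborel)"

locale exp_fam =
  fixes E :: "'x exp_family"
  assumes exp_fam: "exponential_family E"
begin

sublocale base: sigma_finite_measure "ef_base E"
  using exp_fam by (simp add: exponential_family_def)

lemma measurable_ef [measurable]:
  "ef_Theta E \<in> sets borel"
  "ef_a E \<in> borel_measurable (ef_base E)"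
  "ef_h E \<in> borel_measurable (ef_base E)"
  "ef_b E \<in> borel_measurable borel"
  "ef_c E \<in> borel_measurable borel"
  using exp_fam by (auto simp: exponential_family_def)

lemma ef_a_nonneg: "x \<in> space (ef_base E) \<Longrightarrow> 0 \<le> ef_a E x"
  and ef_b_pos: "\<theta> \<in> ef_Theta E \<Longrightarrow> 0 < ef_b E \<theta>"
  and nn_integral_ef_density:
    "\<theta> \<in> ef_Theta E \<Longrightarrow> (\<integral>\<^sup>+x. ennreal (ef_density E \<theta> x) \<partial>ef_base E) = 1"
  using exp_fam by (auto simp: exponential_family_def)

lemma ef_density_nonneg:
  "\<theta> \<in> ef_Theta E \<Longrightarrow> x \<in> space (ef_base E) \<Longrightarrow> 0 \<le> ef_density E \<theta> x"
  using ef_a_nonneg ef_b_pos by (fastforce simp: ef_density_def less_imp_le)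

lemma measurable_ef_density [measurable]:
  assumes [measurable]: "f \<in> borel_measurable N" "g \<in> measurable N (ef_base E)"
  shows "(\<lambda>z. ef_density E (f z) (g z)) \<in> borel_measurable N"
  unfolding ef_density_def by measurable

lemma measurable_conj_kernel [measurable]:
  assumes [measurable]: "f \<in> borel_measurable N" "g \<in> borel_measurable N"
  shows "(\<lambda>z. conj_kernel E s (f z) (g z)) \<in> borel_measurable N"
  unfolding conj_kernel_def by measurable

lemma conj_kernel_nonneg: "0 \<le> conj_kernel E s t \<theta>"
  by (simp add: conj_kernel_def)

lemma measurable_nn_K [measurable]:
  assumes [measurable]: "f \<in> borel_measurable N"
  shows "(\<lambda>z. nn_K E s (f z)) \<in> borel_measurable N"
  unfolding nn_K_def by measurable

lemma nn_K_altdef: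
  "nn_K E s t = (\<integral>\<^sup>+\<theta>. ennreal (indicat_real (ef_Theta E) \<theta> * conj_kernel E s t \<theta>) \<partial>lborel)"
  unfolding nn_K_def by (intro nn_integral_cong) (auto split: split_indicator)

text \<open>This also covers divergence, where the Bochner integral and \<open>enn2real\<close> both
  default to 0.\<close>

lemma conj_K_eq: "conj_K E s t = enn2real (nn_K E s t)"
  unfolding conj_K_def set_lebesgue_integral_def nn_K_altdef real_scaleR_def
  by (rule integral_eq_nn_integral) (auto simp: conj_kernel_nonneg)

lemma conj_K_nonneg: "0 \<le> conj_K E s t"
  by (simp add: conj_K_eq)

lemma measurable_conj_K [measurable]:
  assumes [measurable]: "f \<in> borel_measurable N"
  shows "(\<lambda>z. conj_K E s (f z)) \<in> borel_measurable N"
  unfolding conj_K_eq by measurable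

lemma conj_K_finite_iff: "conj_K_finite E s t \<longleftrightarrow> nn_K E s t < \<infinity>"
  unfolding conj_K_finite_def set_integrable_def nn_K_altdef real_scaleR_def
  by (simp add: integrable_iff_bounded conj_kernel_nonneg abs_mult)

lemma pgf_dom_iff: "t \<in> pgf_dom E \<tau>0 m \<longleftrightarrow> nn_K E (\<tau>0 + real m) t < \<infinity>"
  by (simp add: pgf_dom_def conj_K_finite_iff)

text \<open>Conjugacy: the powers of \<open>ef_b\<close> add up and so do the exponents. Restricting
  to \<open>ef_Theta\<close> makes \<open>ef_b\<close> positive, so that \<open>powr\<close> agrees
  with the ordinary power.\<close>

lemma conj_kernel_times_densities:
  assumes "\<theta> \<in> ef_Theta E" "finite I"
  shows "conj_kernel E s t \<theta> * (\<Prod>j\<in>I. ef_density E \<theta> (x j)) =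
    (\<Prod>j\<in>I. ef_a E (x j)) * conj_kernel E (s + real (card I)) (t + (\<Sum>j\<in>I. ef_h E (x j))) \<theta>"
  using ef_b_pos[OF assms(1)]
  by (simp add: ef_density_def conj_kernel_def prod.distrib powr_add powr_realpow exp_sum
      exp_add sum_distrib_left assms algebra_simps)

text \<open>By conjugacy the integrand is the kernel times one density; Tonelli integrates the data
  point first, and the density has mass 1. This controls the numerator of the predictive generating
  function.\<close>

lemma nn_K_update:
  "(\<integral>\<^sup>+x. ennreal (ef_a E x) * nn_K E (s + 1) (t + ef_h E x) \<partial>ef_base E) = nn_K E s t"
proof -
  interpret P: pair_sigma_finite "ef_base E" lborel ..
  have "(\<integral>\<^sup>+x. ennreal (ef_a E x) * nn_K E (s + 1) (t + ef_h E x) \<partial>ef_base E) =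
    (\<integral>\<^sup>+x. (\<integral>\<^sup>+\<theta>. ennreal (ef_a E x) *
       (indicator (ef_Theta E) \<theta> * ennreal (conj_kernel E (s + 1) (t + ef_h E x) \<theta>)) \<partial>lborel) \<partial>ef_base E)"
    unfolding nn_K_def by (simp add: nn_integral_cmult)
  also have "\<dots> = (\<integral>\<^sup>+x. (\<integral>\<^sup>+\<theta>. indicator (ef_Theta E) \<theta> * ennreal (conj_kernel E s t \<theta>) *
       ennreal (ef_density E \<theta> x) \<partial>lborel) \<partial>ef_base E)"
  proof (intro nn_integral_cong)
    fix x \<theta> assume "x \<in> space (ef_base E)"
    then show "ennreal (ef_a E x) *
       (indicator (ef_Theta E) \<theta> * ennreal (conj_kernel E (s + 1) (t + ef_h E x) \<theta>)) =
       indicator (ef_Theta E) \<theta> * ennreal (conj_kernel E s t \<theta>) * ennreal (ef_density E \<theta> x)"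
      \<comment> \<open>One data point is a sample over a singleton index set; the index 0 is
        arbitrary.\<close>
      using conj_kernel_times_densities[of \<theta> "{0::nat}" s t "\<lambda>_. x"]
      by (auto split: split_indicator simp: ef_a_nonneg conj_kernel_nonneg ef_density_nonneg
          simp flip: ennreal_mult)
  qed
  also have "\<dots> = (\<integral>\<^sup>+\<theta>. (\<integral>\<^sup>+x. indicator (ef_Theta E) \<theta> * ennreal (conj_kernel E s t \<theta>) *
       ennreal (ef_density E \<theta> x) \<partial>ef_base E) \<partial>lborel)"
    by (rule P.Fubini'[symmetric]) measurable
  also have "\<dots> = nn_K E s t"
    unfolding nn_K_def
    by (intro nn_integral_cong)
       (auto simp: nn_integral_cmult nn_integral_ef_density split: split_indicator)
  finally show ?thesis .
qed

section \<open>The predictive generating function\<close>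

lemma measurable_pred_gen_fun [measurable]:
  assumes [measurable]: "A \<in> sets (ef_base E)" "f \<in> borel_measurable N"
  shows "(\<lambda>z. pred_gen_fun E \<tau>0 A m (f z)) \<in> borel_measurable N"
  unfolding pred_gen_fun_def set_lebesgue_integral_def by measurable

lemma pred_gen_fun_nonneg:
  assumes "A \<in> sets (ef_base E)"
  shows "0 \<le> pred_gen_fun E \<tau>0 A m t"
  unfolding pred_gen_fun_def set_lebesgue_integral_def
  by (rule Bochner_Integration.integral_nonneg)
     (auto simp: ef_a_nonneg conj_K_nonneg split: split_indicator)

text \<open>Clearing the denominator moves the real-valued definition into extended reals, where the
  Tonelli arguments take place, and remains meaningful when the denominator is 0.\<close>

lemma pred_gen_fun_times_nn_K:
  assumes [measurable]: "A \<in> sets (ef_base E)"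
    and fin: "nn_K E (\<tau>0 + real m) t < \<infinity>"
  shows "ennreal (pred_gen_fun E \<tau>0 A m t) * nn_K E (\<tau>0 + real m) t =
    (\<integral>\<^sup>+x. indicator A x * (ennreal (ef_a E x) * nn_K E (\<tau>0 + real m + 1) (t + ef_h E x)) \<partial>ef_base E)"
    (is "_ = ?R")
proof -
  let ?s = "\<tau>0 + real m"
  \<comment> \<open>Integrating over \<open>A\<close> gives at most the integral over the whole data
    space, which \<open>nn_K_update\<close> evaluates.\<close>
  have le: "?R \<le> nn_K E ?s t"
    by (subst (2) nn_K_update[symmetric], intro nn_integral_mono) (auto split: split_indicator)
  define r where "r = enn2real (nn_K E ?s t)"
  have r: "nn_K E ?s t = ennreal r" "0 \<le> r"
    using fin by (auto simp: r_def)
  show ?thesis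
  proof (cases "r = 0")
    case True
    then show ?thesis using le r by simp
  next
    case False
    with r have rpos: "0 < r" by simp
    \<comment> \<open>The integrand has finite total mass, hence is finite almost everywhere. Where
      \<open>ef_a\<close> is positive, the numerator \<open>conj_K\<close> is thus the true value of
      the integral and not a default.\<close>
    have AE_fin: "AE x in ef_base E. ennreal (ef_a E x) * nn_K E (?s + 1) (t + ef_h E x) \<noteq> \<infinity>"
      using fin by (intro nn_integral_PInf_AE) (auto simp: nn_K_update)
    have AE_eq: "AE x in ef_base E.
       ennreal (indicat_real A x * (ef_a E x * (conj_K E (?s + 1) (t + ef_h E x) / conj_K E ?s t))) =
       ennreal (1 / r) * (indicator A x * (ennreal (ef_a E x) * nn_K E (?s + 1) (t + ef_h E x)))"
      using AE_fin AE_space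
    proof eventually_elim
      case (elim x)
      note a = ef_a_nonneg[OF elim(2)]
      show ?case
      proof (cases "ef_a E x = 0")
        case False
        with a elim(1) have "nn_K E (?s + 1) (t + ef_h E x) \<noteq> \<infinity>"
          by (auto simp: ennreal_mult_eq_top_iff)
        then obtain q where q: "nn_K E (?s + 1) (t + ef_h E x) = ennreal q" "0 \<le> q"
          by (cases "nn_K E (?s + 1) (t + ef_h E x)") auto
        show ?thesis
          using a q r rpos
          by (auto simp: conj_K_eq simp flip: ennreal_mult split: split_indicator)
      qed simp
    qed
    have "pred_gen_fun E \<tau>0 A m t = enn2real (\<integral>\<^sup>+x.
       ennreal (indicat_real A x * (ef_a E x * (conj_K E (?s + 1) (t + ef_h E x) / conj_K E ?s t))) \<partial>ef_base E)"
      unfolding pred_gen_fun_def set_lebesgue_integral_def real_scaleR_def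
      by (rule integral_eq_nn_integral)
         (auto intro!: AE_I2 simp: ef_a_nonneg conj_K_nonneg split: split_indicator)
    also have "\<dots> = enn2real (ennreal (1 / r) * ?R)"
      by (subst nn_integral_cong_AE[OF AE_eq]) (simp add: nn_integral_cmult)
    finally have F: "pred_gen_fun E \<tau>0 A m t = enn2real (ennreal (1 / r) * ?R)" .
    obtain q where q: "?R = ennreal q" "0 \<le> q"
      using le r by (cases ?R) (auto simp: top_unique)
    show ?thesis
      unfolding F q r using rpos q(2) by (simp flip: ennreal_mult)
  qed
qed

end

section \<open>Predictive distributions\<close>

text \<open>The index set \<open>J\<close> is abstract, so that one marginal law for subsets of
  \<open>J\<close> serves a private sample, the pooled sample, and either of them with the
  unobserved point adjoined.\<close>

locale conj_sample = exp_fam E + prob_space M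
  for E :: "'x exp_family" and M :: "'w measure" +
  fixes \<tau>0 \<tau>1 :: real and J :: "nat set" and \<Theta> :: "'w \<Rightarrow> real" and X :: "nat \<Rightarrow> 'w \<Rightarrow> 'x"
  assumes finite_J: "finite J"
    and joint_law: "distributed M (lborel \<Otimes>\<^sub>M (\<Pi>\<^sub>M j\<in>J. ef_base E))
      (\<lambda>\<omega>. (\<Theta> \<omega>, \<lambda>j\<in>J. X j \<omega>))
      (\<lambda>(\<theta>, x). ennreal (conj_prior E \<tau>0 \<tau>1 \<theta> * (\<Prod>j\<in>J. ef_density E \<theta> (x j))))"
begin

lemma measurable_X:
  assumes "j \<in> J"
  shows "X j \<in> measurable M (ef_base E)"
proof -
  have "(\<lambda>\<omega>. snd (\<Theta> \<omega>, \<lambda>j\<in>J. X j \<omega>) j) \<in> measurable M (ef_base E)"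
    by (rule measurable_compose[OF distributed_measurable[OF joint_law]
          measurable_compose[OF measurable_snd measurable_component_singleton[OF assms]]])
  then show ?thesis using assms by simp
qed

lemma measurable_sample:
  "I \<subseteq> J \<Longrightarrow> (\<lambda>\<omega>. \<lambda>j\<in>I. X j \<omega>) \<in> measurable M (\<Pi>\<^sub>M j\<in>I. ef_base E)"
  by (intro measurable_restrict measurable_X) auto

text \<open>The marginal density of the subsample \<open>I\<close>, with the parameter integrated
  out, relative to the product of base measures.\<close>

definition weight :: "nat set \<Rightarrow> (nat \<Rightarrow> 'x) \<Rightarrow> ennreal" where
  "weight I x = ennreal (1 / conj_K E \<tau>0 \<tau>1) * (ennreal (\<Prod>j\<in>I. ef_a E (x j)) *
     nn_K E (\<tau>0 + real (card I)) (\<tau>1 + (\<Sum>j\<in>I. ef_h E (x j))))"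

lemma measurable_weight [measurable]: "weight I \<in> borel_measurable (\<Pi>\<^sub>M j\<in>I. ef_base E)"
  unfolding weight_def by measurable

lemma nn_integral_prior_densities:
  assumes fin: "finite I" and x: "x \<in> space (\<Pi>\<^sub>M j\<in>I. ef_base E)"
  shows "(\<integral>\<^sup>+\<theta>. ennreal (conj_prior E \<tau>0 \<tau>1 \<theta> * (\<Prod>j\<in>I. ef_density E \<theta> (x j))) \<partial>lborel) = weight I x"
proof -
  have a: "0 \<le> (\<Prod>j\<in>I. ef_a E (x j))"
    using x by (intro prod_nonneg ef_a_nonneg) (auto simp: space_PiM)
  have *: "conj_prior E \<tau>0 \<tau>1 \<theta> * (\<Prod>j\<in>I. ef_density E \<theta> (x j)) =
      1 / conj_K E \<tau>0 \<tau>1 * ((\<Prod>j\<in>I. ef_a E (x j)) * (indicat_real (ef_Theta E) \<theta> *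
        conj_kernel E (\<tau>0 + real (card I)) (\<tau>1 + (\<Sum>j\<in>I. ef_h E (x j))) \<theta>))" for \<theta>
    using conj_kernel_times_densities[OF _ fin, of \<theta> \<tau>0 \<tau>1 x]
    by (auto simp: conj_prior_def split: split_indicator)
  show ?thesis
    unfolding * weight_def nn_K_altdef using a conj_K_nonneg[of \<tau>0 \<tau>1]
    by (subst ennreal_mult', simp, subst ennreal_mult', simp) (simp add: nn_integral_cmult)
qed

text \<open>For a fixed parameter in \<open>ef_Theta\<close> the points outside \<open>I\<close> are
  independent of those in \<open>I\<close> and their densities integrate to 1; outside
  \<open>ef_Theta\<close> the prior vanishes.\<close>

lemma nn_integral_prior_marginal:
  assumes I: "I \<subseteq> J" and [measurable]: "g \<in> borel_measurable (\<Pi>\<^sub>M j\<in>I. ef_base E)"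
  shows "(\<integral>\<^sup>+x. ennreal (conj_prior E \<tau>0 \<tau>1 \<theta> * (\<Prod>j\<in>J. ef_density E \<theta> (x j))) * g (restrict x I)
      \<partial>(\<Pi>\<^sub>M j\<in>J. ef_base E)) =
    (\<integral>\<^sup>+x. ennreal (conj_prior E \<tau>0 \<tau>1 \<theta> * (\<Prod>j\<in>I. ef_density E \<theta> (x j))) * g x
      \<partial>(\<Pi>\<^sub>M j\<in>I. ef_base E))"
proof (cases "\<theta> \<in> ef_Theta E")
  case False
  then show ?thesis by (simp add: conj_prior_def)
next
  case True
  interpret product_sigma_finite "\<lambda>_::nat. ef_base E" ..
  define K where "K = J - I"
  have K: "J = I \<union> K" "I \<inter> K = {}" "finite I" "finite K"
    using I finite_J finite_subset by (auto simp: K_def)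
  have [measurable]: "(\<lambda>x. restrict x I) \<in> measurable (\<Pi>\<^sub>M j\<in>I\<union>K. ef_base E) (\<Pi>\<^sub>M j\<in>I. ef_base E)"
    by (rule measurable_restrict_subset) auto
  have prior: "0 \<le> conj_prior E \<tau>0 \<tau>1 \<theta>"
    by (auto simp: conj_prior_def conj_kernel_nonneg conj_K_nonneg)
  have split: "ennreal (conj_prior E \<tau>0 \<tau>1 \<theta> *
        (\<Prod>j\<in>I \<union> K. ef_density E \<theta> (merge I K (x, y) j))) * g (restrict (merge I K (x, y)) I) =
      ennreal (conj_prior E \<tau>0 \<tau>1 \<theta> * (\<Prod>j\<in>I. ef_density E \<theta> (x j))) * g x *
        (\<Prod>j\<in>K. ennreal (ef_density E \<theta> (y j)))"
    if x: "x \<in> space (\<Pi>\<^sub>M j\<in>I. ef_base E)" and y: "y \<in> space (\<Pi>\<^sub>M j\<in>K. ef_base E)" for x y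
  proof -
    have r: "restrict (merge I K (x, y)) I = x"
      using x K(2) by (auto simp: space_PiM PiE_iff extensional_def merge_def fun_eq_iff)
    have 1: "(\<Prod>j\<in>I. ef_density E \<theta> (merge I K (x, y) j)) = (\<Prod>j\<in>I. ef_density E \<theta> (x j))"
      by (intro prod.cong) (auto simp: merge_def)
    have 2: "(\<Prod>j\<in>K. ef_density E \<theta> (merge I K (x, y) j)) = (\<Prod>j\<in>K. ef_density E \<theta> (y j))"
      using K(2) by (intro prod.cong) (auto simp: merge_def)
    have nnx: "0 \<le> (\<Prod>j\<in>I. ef_density E \<theta> (x j))"
      using x True by (intro prod_nonneg ef_density_nonneg) (auto simp: space_PiM)
    have nny: "ennreal (\<Prod>j\<in>K. ef_density E \<theta> (y j)) = (\<Prod>j\<in>K. ennreal (ef_density E \<theta> (y j)))"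
      "0 \<le> (\<Prod>j\<in>K. ef_density E \<theta> (y j))"
      using y True by (auto intro!: prod_ennreal[symmetric] prod_nonneg ef_density_nonneg
          simp: space_PiM)
    show ?thesis
      unfolding prod.union_disjoint[OF K(3,4,2)] r 1 2 nny(1)[symmetric]
      using prior nnx nny(2) by (simp add: ennreal_mult mult_ac)
  qed
  have one: "(\<integral>\<^sup>+y. (\<Prod>j\<in>K. ennreal (ef_density E \<theta> (y j))) \<partial>(\<Pi>\<^sub>M j\<in>K. ef_base E)) = 1"
    using K(4) True
    by (subst product_nn_integral_prod) (auto simp: nn_integral_ef_density)
  show ?thesis
    unfolding K(1)
    by (subst product_nn_integral_fold[OF K(2,3,4)])
       (auto intro!: nn_integral_cong simp: split nn_integral_cmult one cong: nn_integral_cong)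
qed

text \<open>\<open>weight I\<close> is the density of the subsample: transfer to the joint density,
  drop the coordinates outside \<open>I\<close>, then exchange the order of integration so that the
  parameter is integrated out.\<close>

lemma nn_integral_sample:
  assumes I: "I \<subseteq> J" and [measurable]: "g \<in> borel_measurable (\<Pi>\<^sub>M j\<in>I. ef_base E)"
  shows "(\<integral>\<^sup>+\<omega>. g (\<lambda>j\<in>I. X j \<omega>) \<partial>M) = (\<integral>\<^sup>+x. g x * weight I x \<partial>(\<Pi>\<^sub>M j\<in>I. ef_base E))"
proof -
  interpret product_sigma_finite "\<lambda>_::nat. ef_base E" ..
  have fin: "finite I" using I finite_J finite_subset by blast
  interpret PJ: sigma_finite_measure "\<Pi>\<^sub>M j\<in>J. ef_base E"
    by (rule sigma_finite[OF finite_J])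
  interpret PI: sigma_finite_measure "\<Pi>\<^sub>M j\<in>I. ef_base E"
    by (rule sigma_finite[OF fin])
  interpret Q: pair_sigma_finite "lborel::real measure" "\<Pi>\<^sub>M j\<in>I. ef_base E" ..
  have [measurable]: "(\<lambda>x. restrict x I) \<in> measurable (\<Pi>\<^sub>M j\<in>J. ef_base E) (\<Pi>\<^sub>M j\<in>I. ef_base E)"
    by (rule measurable_restrict_subset[OF I])
  have [measurable]: "conj_prior E \<tau>0 \<tau>1 \<in> borel_measurable borel"
    unfolding conj_prior_def by measurable
  let ?d = "\<lambda>S \<theta> x. ennreal (conj_prior E \<tau>0 \<tau>1 \<theta> * (\<Prod>j\<in>S. ef_density E \<theta> (x j)))"
  have "(\<integral>\<^sup>+\<omega>. g (\<lambda>j\<in>I. X j \<omega>) \<partial>M) =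
      (\<integral>\<^sup>+\<omega>. g (restrict (snd (\<Theta> \<omega>, \<lambda>j\<in>J. X j \<omega>)) I) \<partial>M)"
    using I by (simp add: restrict_restrict Int_absorb1)
  also have "\<dots> = (\<integral>\<^sup>+z. (case z of (\<theta>, x) \<Rightarrow> ?d J \<theta> x) * g (restrict (snd z) I)
      \<partial>(lborel \<Otimes>\<^sub>M (\<Pi>\<^sub>M j\<in>J. ef_base E)))"
    by (rule distributed_nn_integral[OF joint_law, symmetric]) measurable
  also have "\<dots> = (\<integral>\<^sup>+\<theta>. \<integral>\<^sup>+x. ?d J \<theta> x * g (restrict x I) \<partial>(\<Pi>\<^sub>M j\<in>J. ef_base E) \<partial>lborel)"
    by (subst PJ.nn_integral_fst[symmetric]) (auto simp: case_prod_beta')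
  also have "\<dots> = (\<integral>\<^sup>+\<theta>. \<integral>\<^sup>+x. ?d I \<theta> x * g x \<partial>(\<Pi>\<^sub>M j\<in>I. ef_base E) \<partial>lborel)"
    by (simp add: nn_integral_prior_marginal[OF I])
  also have "\<dots> = (\<integral>\<^sup>+x. \<integral>\<^sup>+\<theta>. ?d I \<theta> x * g x \<partial>lborel \<partial>(\<Pi>\<^sub>M j\<in>I. ef_base E))"
    by (rule Q.Fubini'[symmetric]) (simp add: case_prod_beta')
  also have "\<dots> = (\<integral>\<^sup>+x. g x * weight I x \<partial>(\<Pi>\<^sub>M j\<in>I. ef_base E))"
  proof (rule nn_integral_cong)
    fix x assume x: "x \<in> space (\<Pi>\<^sub>M j\<in>I. ef_base E)"
    have "(\<lambda>\<theta>. ?d I \<theta> x) \<in> borel_measurable lborel"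
      unfolding ef_density_def by measurable
    then show "(\<integral>\<^sup>+\<theta>. ?d I \<theta> x * g x \<partial>lborel) = g x * weight I x"
      by (simp add: nn_integral_multc nn_integral_prior_densities[OF fin x] mult.commute[of "g x"])
  qed
  finally show ?thesis .
qed

lemma AE_weight:
  assumes I: "I \<subseteq> J"
  shows "AE \<omega> in M. weight I (\<lambda>j\<in>I. X j \<omega>) \<noteq> 0 \<and> weight I (\<lambda>j\<in>I. X j \<omega>) \<noteq> \<infinity>"
proof -
  let ?P = "\<Pi>\<^sub>M j\<in>I. ef_base E"
  note [measurable] = measurable_sample[OF I]
  have "(\<integral>\<^sup>+x. weight I x \<partial>?P) = 1"
    using nn_integral_sample[OF I, of "\<lambda>_. 1"] by (simp add: emeasure_space_1)
  then have "AE x in ?P. weight I x \<noteq> \<infinity>"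
    by (intro nn_integral_PInf_AE) auto
  \<comment> \<open>Where the weight is 0 the integrand vanishes, and an infinite weight occurs only
    on a null set of the product base measure.\<close>
  then have "(\<integral>\<^sup>+x. indicator {x \<in> space ?P. weight I x = 0 \<or> weight I x = \<infinity>} x * weight I x \<partial>?P) = 0"
    by (subst nn_integral_0_iff_AE) (auto split: split_indicator elim!: eventually_mono)
  then have "(\<integral>\<^sup>+\<omega>. indicator {x \<in> space ?P. weight I x = 0 \<or> weight I x = \<infinity>} (\<lambda>j\<in>I. X j \<omega>) \<partial>M) = 0"
    by (subst nn_integral_sample[OF I]) auto
  then have "AE \<omega> in M. indicator {x \<in> space ?P. weight I x = 0 \<or> weight I x = \<infinity>} (\<lambda>j\<in>I. X j \<omega>) = (0::ennreal)"
    by (subst (asm) nn_integral_0_iff_AE) auto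
  with AE_space show ?thesis
  proof eventually_elim
    case (elim \<omega>)
    then show ?case
      using measurable_space[OF measurable_sample[OF I] elim(1)] by (auto split: split_indicator_asm)
  qed
qed

text \<open>A nonzero weight has nonzero prefactors, so an infinite \<open>nn_K\<close> would make
  it infinite. This places the updated hyperparameter in the domain of the generating function
  almost surely.\<close>

lemma AE_posterior_finite:
  assumes I: "I \<subseteq> J"
  shows "AE \<omega> in M. nn_K E (\<tau>0 + real (card I)) (\<tau>1 + (\<Sum>j\<in>I. ef_h E (X j \<omega>))) < \<infinity>"
  using AE_weight[OF I]
proof eventually_elim
  case (elim \<omega>)
  then show ?case
    by (auto simp: weight_def less_top ennreal_mult_eq_top_iff)
qed

text \<open>The unnormalised posterior kernel cancels against the denominator of the predictive
  generating function; where that kernel is infinite,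
  the weight is either 0 or, on a null set only, infinite.\<close>
lemma nn_integral_pred_gen_fun:
  assumes I: "I \<subseteq> J" and l: "l \<in> J" "l \<notin> I" and [measurable]: "A \<in> sets (ef_base E)"
    and [measurable]: "g \<in> borel_measurable (\<Pi>\<^sub>M j\<in>I. ef_base E)"
  shows "(\<integral>\<^sup>+\<omega>. g (\<lambda>j\<in>I. X j \<omega>) * indicator A (X l \<omega>) \<partial>M) =
    (\<integral>\<^sup>+\<omega>. g (\<lambda>j\<in>I. X j \<omega>) *
       ennreal (pred_gen_fun E \<tau>0 A (card I) (\<tau>1 + (\<Sum>j\<in>I. ef_h E (X j \<omega>)))) \<partial>M)"
proof -
  interpret product_sigma_finite "\<lambda>_::nat. ef_base E" ..
  have fin: "finite I" using I finite_J finite_subset by blast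
  let ?P = "\<Pi>\<^sub>M j\<in>I. ef_base E" and ?Q = "\<Pi>\<^sub>M j\<in>insert l I. ef_base E"
  have lI: "insert l I \<subseteq> J" using I l by auto
  have [measurable]: "(\<lambda>x. restrict x I) \<in> measurable ?Q ?P"
    by (rule measurable_restrict_subset) auto
  let ?T = "\<lambda>x. \<tau>1 + (\<Sum>j\<in>I. ef_h E (x j))"
  let ?C = "\<lambda>x. ennreal (1 / conj_K E \<tau>0 \<tau>1) * ennreal (\<Prod>j\<in>I. ef_a E (x j))"
  have "(\<integral>\<^sup>+\<omega>. g (\<lambda>j\<in>I. X j \<omega>) * indicator A (X l \<omega>) \<partial>M) =
     (\<integral>\<^sup>+\<omega>. (\<lambda>x. g (restrict x I) * indicator A (x l)) (\<lambda>j\<in>insert l I. X j \<omega>) \<partial>M)"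
    by (simp add: restrict_restrict Int_absorb1 subset_insertI)
  \<comment> \<open>The marginal law is used for the sample enlarged by the point \<open>l\<close>,
    whose coordinate is then split off as the inner variable \<open>z\<close>.\<close>
  also have "\<dots> = (\<integral>\<^sup>+x. g (restrict x I) * indicator A (x l) * weight (insert l I) x \<partial>?Q)"
    by (rule nn_integral_sample[OF lI]) measurable
  also have "\<dots> = (\<integral>\<^sup>+x. \<integral>\<^sup>+z. g (restrict (x(l := z)) I) * indicator A ((x(l := z)) l) *
      weight (insert l I) (x(l := z)) \<partial>ef_base E \<partial>?P)"
    by (rule product_nn_integral_insert[OF fin l(2)]) measurable
  also have "\<dots> = (\<integral>\<^sup>+x. \<integral>\<^sup>+z. g x * ?C x * (indicator A z * (ennreal (ef_a E z) *
      nn_K E (\<tau>0 + real (card I) + 1) (?T x + ef_h E z))) \<partial>ef_base E \<partial>?P)"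
  proof (intro nn_integral_cong)
    fix x z assume x: "x \<in> space ?P" and z: "z \<in> space (ef_base E)"
    have r: "restrict (x(l := z)) I = x"
      using x l by (auto simp: space_PiM PiE_iff extensional_def fun_eq_iff)
    have 1: "(\<Prod>j\<in>I. ef_a E ((x(l := z)) j)) = (\<Prod>j\<in>I. ef_a E (x j))"
      and 2: "(\<Sum>j\<in>I. ef_h E ((x(l := z)) j)) = (\<Sum>j\<in>I. ef_h E (x j))"
      using l by (auto intro!: prod.cong sum.cong)
    have a: "0 \<le> (\<Prod>j\<in>I. ef_a E (x j))" "0 \<le> ef_a E z"
      using x z by (auto intro!: prod_nonneg ef_a_nonneg simp: space_PiM)
    show "g (restrict (x(l := z)) I) * indicator A ((x(l := z)) l) * weight (insert l I) (x(l := z)) =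
      g x * ?C x * (indicator A z * (ennreal (ef_a E z) *
        nn_K E (\<tau>0 + real (card I) + 1) (?T x + ef_h E z)))"
      unfolding r weight_def prod.insert[OF fin l(2)] sum.insert[OF fin l(2)]
        card_insert_disjoint[OF fin l(2)] 1 2 fun_upd_same
      using a by (simp add: ennreal_mult ac_simps)
  qed
  also have "\<dots> = (\<integral>\<^sup>+x. g x * ?C x * (\<integral>\<^sup>+z. indicator A z * (ennreal (ef_a E z) *
      nn_K E (\<tau>0 + real (card I) + 1) (?T x + ef_h E z)) \<partial>ef_base E) \<partial>?P)"
    by (intro nn_integral_cong nn_integral_cmult) measurable
  also have "\<dots> = (\<integral>\<^sup>+x. g x * ennreal (pred_gen_fun E \<tau>0 A (card I) (?T x)) * weight I x \<partial>?P)"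
  proof (rule nn_integral_cong_AE)
    have "(\<integral>\<^sup>+x. weight I x \<partial>?P) = 1"
      using nn_integral_sample[OF I, of "\<lambda>_. 1"] by (simp add: emeasure_space_1)
    then have "AE x in ?P. weight I x \<noteq> \<infinity>"
      by (intro nn_integral_PInf_AE) auto
    then show "AE x in ?P. g x * ?C x * (\<integral>\<^sup>+z. indicator A z * (ennreal (ef_a E z) *
        nn_K E (\<tau>0 + real (card I) + 1) (?T x + ef_h E z)) \<partial>ef_base E) =
      g x * ennreal (pred_gen_fun E \<tau>0 A (card I) (?T x)) * weight I x"
    proof eventually_elim
      case (elim x)
      show ?case
      proof (cases "?C x = 0")
        case False
        then have "nn_K E (\<tau>0 + real (card I)) (?T x) < \<infinity>"
          using elim by (auto simp: weight_def less_top ennreal_mult_eq_top_iff)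
        from pred_gen_fun_times_nn_K[OF \<open>A \<in> sets (ef_base E)\<close> this] show ?thesis
          by (simp add: weight_def ac_simps)
      qed (auto simp: weight_def)
    qed
  qed
  also have "\<dots> = (\<integral>\<^sup>+\<omega>. (\<lambda>x. g x * ennreal (pred_gen_fun E \<tau>0 A (card I) (?T x))) (\<lambda>j\<in>I. X j \<omega>) \<partial>M)"
    by (rule nn_integral_sample[OF I, symmetric]) measurable
  finally show ?thesis by simp
qed

end

section \<open>Conditional probability of the event given a subsample\<close>

context conj_sample
begin

lemma subalgebra_sample: "I \<subseteq> J \<Longrightarrow> subalgebra M (sigma_gen M (ef_base E) I X)"
  by (intro subalgebra_sigma_gen) (auto intro: measurable_X)

lemma measurable_sample_sigma_gen:
  assumes "I \<subseteq> J" "j \<in> I"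
  shows "X j \<in> measurable (sigma_gen M (ef_base E) I X) (ef_base E)"
  using assms measurable_space[OF measurable_X] by (intro measurable_sigma_gen) auto

lemma sets_event:
  "l \<in> J \<Longrightarrow> A \<in> sets (ef_base E) \<Longrightarrow> {\<omega> \<in> space M. X l \<omega> \<in> A} \<in> sets M"
  using measurable_sets[OF measurable_X, of l A] by (simp add: vimage_def Int_def conj_commute)

text \<open>The right-hand side is a measurable function of the subsample, so it remains to match
  integrals over the events that the subsample lies in \<open>B\<close>; that is
  \<open>nn_integral_pred_gen_fun\<close> with \<open>g\<close> the indicator of
  \<open>B\<close>.\<close>

lemma cond_prob_sample:
  assumes I: "I \<subseteq> J" and l: "l \<in> J" "l \<notin> I" and A: "A \<in> sets (ef_base E)"
  shows "AE \<omega> in M.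
    real_cond_exp M (sigma_gen M (ef_base E) I X) (indicat_real {\<omega> \<in> space M. X l \<omega> \<in> A}) \<omega> =
    pred_gen_fun E \<tau>0 A (card I) (\<tau>1 + (\<Sum>j\<in>I. ef_h E (X j \<omega>)))"
proof -
  let ?H = "sigma_gen M (ef_base E) I X"
  let ?f = "indicat_real {\<omega> \<in> space M. X l \<omega> \<in> A}"
  let ?g = "\<lambda>\<omega>. pred_gen_fun E \<tau>0 A (card I) (\<tau>1 + (\<Sum>j\<in>I. ef_h E (X j \<omega>)))"
  interpret H: finite_measure_subalgebra M ?H
    by standard (rule subalgebra_sample[OF I])
  note [measurable] = A sets_event[OF l(1) A] measurable_X[OF l(1)]
  have gH: "?g \<in> borel_measurable ?H"
  proof -
    note [measurable] = measurable_sample_sigma_gen[OF I]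
    show ?thesis by measurable
  qed
  have gM [measurable]: "?g \<in> borel_measurable M"
    by (rule measurable_from_subalg[OF subalgebra_sample[OF I] gH])
  have g_nonneg: "0 \<le> ?g \<omega>" for \<omega> by (rule pred_gen_fun_nonneg[OF A])
  \<comment> \<open>The same identity with constant \<open>g\<close> bounds the integral by 1 and
    gives integrability.\<close>
  have "(\<integral>\<^sup>+\<omega>. ennreal (?g \<omega>) \<partial>M) = (\<integral>\<^sup>+\<omega>. indicator A (X l \<omega>) \<partial>M)"
    using nn_integral_pred_gen_fun[OF I l A, of "\<lambda>_. 1"] by simp
  also have "\<dots> \<le> (\<integral>\<^sup>+\<omega>. 1 \<partial>M)"
    by (intro nn_integral_mono) (auto split: split_indicator)
  finally have "(\<integral>\<^sup>+\<omega>. ennreal (?g \<omega>) \<partial>M) < \<infinity>"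
    by (simp add: emeasure_space_1 order_le_less_trans)
  then have g_int: "integrable M ?g"
    using g_nonneg by (intro integrableI_nonneg) auto
  show ?thesis
  proof (rule H.real_cond_exp_charact[OF _ _ g_int gH])
    fix S assume "S \<in> sets ?H"
    then obtain B where [measurable]: "B \<in> sets (\<Pi>\<^sub>M j\<in>I. ef_base E)"
      and S: "S = (\<lambda>\<omega>. \<lambda>j\<in>I. X j \<omega>) -` B \<inter> space M"
      unfolding sigma_gen_def
      using measurable_space[OF measurable_sample[OF I]]
      by (subst (asm) sets_vimage_algebra2) auto
    have [measurable]: "S \<in> sets M"
      unfolding S by (rule measurable_sets[OF measurable_sample[OF I]]) simp
    have "(\<integral>\<omega>\<in>S. ?f \<omega> \<partial>M) = enn2real (\<integral>\<^sup>+\<omega>. ennreal (indicat_real S \<omega> * ?f \<omega>) \<partial>M)"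
      unfolding set_lebesgue_integral_def real_scaleR_def by (rule integral_eq_nn_integral) auto
    also have "(\<integral>\<^sup>+\<omega>. ennreal (indicat_real S \<omega> * ?f \<omega>) \<partial>M) =
        (\<integral>\<^sup>+\<omega>. indicator B (\<lambda>j\<in>I. X j \<omega>) * indicator A (X l \<omega>) \<partial>M)"
      by (intro nn_integral_cong) (auto simp: S split: split_indicator)
    also have "\<dots> = (\<integral>\<^sup>+\<omega>. indicator B (\<lambda>j\<in>I. X j \<omega>) * ennreal (?g \<omega>) \<partial>M)"
      by (rule nn_integral_pred_gen_fun[OF I l A]) measurable
    also have "\<dots> = (\<integral>\<^sup>+\<omega>. ennreal (indicat_real S \<omega> * ?g \<omega>) \<partial>M)"
      by (intro nn_integral_cong) (auto simp: S split: split_indicator)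
    also have "enn2real \<dots> = (\<integral>\<omega>\<in>S. ?g \<omega> \<partial>M)"
      unfolding set_lebesgue_integral_def real_scaleR_def
      by (rule integral_eq_nn_integral[symmetric]) (auto simp: g_nonneg)
    finally show "(\<integral>\<omega>\<in>S. ?f \<omega> \<partial>M) = (\<integral>\<omega>\<in>S. ?g \<omega> \<partial>M)" .
  qed (simp add: emeasure_eq_measure)
qed

text \<open>The prior prediction is the case of the empty subsample, with cardinality 0 and empty
  sum of statistics.\<close>

lemma prob_event:
  assumes l: "l \<in> J" and A: "A \<in> sets (ef_base E)"
  shows "prob {\<omega> \<in> space M. X l \<omega> \<in> A} = pred_gen_fun E \<tau>0 A 0 \<tau>1"
proof -
  have "emeasure M {\<omega> \<in> space M. X l \<omega> \<in> A} = (\<integral>\<^sup>+\<omega>. indicator {\<omega> \<in> space M. X l \<omega> \<in> A} \<omega> \<partial>M)"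
    by (simp add: sets_event[OF l A])
  also have "\<dots> = (\<integral>\<^sup>+\<omega>. indicator A (X l \<omega>) \<partial>M)"
    by (intro nn_integral_cong) (auto split: split_indicator)
  also have "\<dots> = ennreal (pred_gen_fun E \<tau>0 A 0 \<tau>1)"
    using nn_integral_pred_gen_fun[of "{}" l A "\<lambda>_. 1"] l A by (simp add: emeasure_space_1)
  finally show ?thesis
    by (simp add: measure_def pred_gen_fun_nonneg[OF A])
qed

end

section \<open>The ensemble\<close>

lemma cum_size_Suc: "cum_size n (Suc i) = cum_size n i + n (Suc i)"
  by (simp add: cum_size_def)

lemma cum_size_mono: "i \<le> j \<Longrightarrow> cum_size n i \<le> cum_size n j"
  unfolding cum_size_def by (intro sum_mono2) auto

text \<open>At \<open>i = 0\<close> the subtraction truncates and the block is empty whatever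
  \<open>n 0\<close> is, hence the lower bound on \<open>i\<close>.\<close>

lemma card_private_idx: "1 \<le> i \<Longrightarrow> card (private_idx n i) = n i"
  using cum_size_Suc[of n "i - 1"] by (simp add: private_idx_def)

lemma private_idx_subset: "i \<le> k \<Longrightarrow> private_idx n i \<subseteq> {1..cum_size n k}"
  using cum_size_mono[of i k n] by (auto simp: private_idx_def)

text \<open>The private blocks partition the pooled index range, so the experts' statistics add up
  to the pooled one.\<close>

lemma sum_private_idx:
  "(\<Sum>i=1..k. \<Sum>j\<in>private_idx n i. f j) = (\<Sum>j=1..cum_size n k. f j :: 'a :: comm_monoid_add)"
proof (induction k)
  case 0
  then show ?case by (simp add: cum_size_def)
next
  case (Suc k)
  have "{1..cum_size n (Suc k)} = {1..cum_size n k} \<union> private_idx n (Suc k)"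
    using cum_size_mono[of k "Suc k" n] by (auto simp: private_idx_def)
  then have "(\<Sum>j=1..cum_size n (Suc k). f j) =
      (\<Sum>j=1..cum_size n k. f j) + (\<Sum>j\<in>private_idx n (Suc k). f j)"
    by (simp only:) (intro sum.union_disjoint; auto simp: private_idx_def)
  with Suc show ?case by simp
qed

theorem proposition1:
  fixes M :: "'w measure" and E :: "'x exp_family"
    and \<tau>0 \<tau>1 :: real and n :: "nat \<Rightarrow> nat" and k ns :: nat and A :: "'x set"
    and \<Theta> :: "'w \<Rightarrow> real" and X :: "nat \<Rightarrow> 'w \<Rightarrow> 'x"
    and N :: "nat \<Rightarrow> nat" and y :: "'w \<Rightarrow> real" and p0 :: real
    and p t :: "nat \<Rightarrow> 'w \<Rightarrow> real"
    and F Finv :: "nat \<Rightarrow> real \<Rightarrow> real" and D :: "nat \<Rightarrow> real set"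
  defines "N \<equiv> cum_size n"
    and "y \<equiv> outcome n k ns A X"
    and "p0 \<equiv> measure M {\<omega>\<in>space M. y \<omega> = 1}"
    and "p \<equiv> forecast M E n k ns A X"
    and "t \<equiv> suff_stat E n X"
    and "D \<equiv> pgf_dom E \<tau>0"
    and "F \<equiv> pred_gen_fun E \<tau>0 A"
    and "Finv \<equiv> pred_gen_inv E \<tau>0 A"
  assumes info_structure: "conjugate_pair_structure M E \<tau>0 \<tau>1 n k ns A \<Theta> X"
    and experts: "2 \<le> k"
    and private_info: "\<forall>i\<in>{1..k}. 0 < n i"
    and no_shared: "ns = 0"
    and monotonic: "\<forall>m. monotone_on (D m) (<) (<) (F m) \<or> monotone_on (D m) (<) (>) (F m)"
  shows
    "(\<tau>1 \<in> D 0 \<and> p0 = F 0 \<tau>1)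
     \<and> (\<forall>i\<in>{1..k}. AE \<omega> in M.
            \<tau>1 + t i \<omega> \<in> D (n i) \<and> p i \<omega> = F (n i) (\<tau>1 + t i \<omega>))
     \<and> (AE \<omega> in M. cond_prob_one M y (sigma_gen M borel {1..k} p) \<omega> =
            F (N k) (- (real k - 1) * Finv 0 p0 + (\<Sum>i=1..k. Finv (n i) (p i \<omega>))))
     \<and> generalized_additive_model M y {1..k} p (D (N k)) (F (N k))
            (- (real k - 1) * Finv 0 p0) (\<lambda>i. Finv (n i))
     \<and> (AE \<omega> in M. cond_prob_one M y (sigma_gen M borel {1..k} t) \<omega> =
            F (N k) (\<tau>1 + (\<Sum>i=1..k. t i \<omega>)))
     \<and> generalized_linear_model M y {1..k} t (D (N k)) (F (N k)) \<tau>1 (\<lambda>i s. s)"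
proof -
  define J where "J = {1..last_idx n k ns}"
  define l where "l = last_idx n k ns"
  note info = info_structure[unfolded conjugate_pair_structure_def, folded J_def]
  interpret prob_space M using info by simp
  interpret conj_sample E M \<tau>0 \<tau>1 J \<Theta> X
    using info by unfold_locales (auto simp: J_def)
  have A: "A \<in> sets (ef_base E)" using info by simp
  \<comment> \<open>The final \<open>+ 1\<close> in \<open>last_idx\<close> puts the predicted point
    beyond every observed index.\<close>
  have l: "l \<in> J" "l \<notin> {1..N k}" and NJ: "{1..N k} \<subseteq> J"
    by (auto simp: l_def J_def last_idx_def N_def)
  define Y where "Y = {\<omega> \<in> space M. X l \<omega> \<in> A}"
  have Y_eq: "{\<omega> \<in> space M. y \<omega> = 1} = Y"
    by (auto simp: y_def outcome_def l_def Y_def)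
  have Y [measurable]: "Y \<in> sets M"
    unfolding Y_def by (rule sets_event[OF l(1) A])
  have Y_int: "integrable M (indicat_real Y)"
    by (simp add: emeasure_eq_measure)
  have y_eq: "y \<omega> = indicat_real Y \<omega>" if "\<omega> \<in> space M" for \<omega>
    using that by (auto simp: y_def outcome_def l_def Y_def)
  have inj: "inj_on (F m) (D m)" for m
    using monotonic by (blast intro: inj_on_strict_monotone)
  have Finv_F: "Finv m (F m u) = u" if "u \<in> D m" for m u
    using inv_into_f_f[OF inj that] by (simp add: Finv_def pred_gen_inv_def D_def F_def)
  have "\<forall>m. \<exists>g\<in>borel_measurable borel. \<forall>u\<in>D m. g (F m u) = u"
    using monotonic measurable_left_inverse_strict_monotone by blast
  \<comment> \<open>\<open>Finv m\<close> is constant off the range of \<open>F m\<close>, which need not be Borel; \<open>G m\<close> is a Borel substitute.\<close>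
  then obtain G where G_meas [measurable]: "\<And>m. G m \<in> borel_measurable borel"
    and G: "\<And>m u. u \<in> D m \<Longrightarrow> G m (F m u) = u"
    by metis
  have F_meas [measurable]: "F m \<in> borel_measurable borel" for m
    unfolding F_def by (rule measurable_pred_gen_fun[OF A]) simp

  \<comment> \<open>Prior probability and individual forecasts\<close>
  have \<tau>1: "\<tau>1 \<in> D 0"
    using info by (simp add: D_def pgf_dom_def)
  have p0: "p0 = F 0 \<tau>1"
    unfolding p0_def Y_eq F_def Y_def by (rule prob_event[OF l(1) A])

  have sub: "private_idx n i \<subseteq> {1..N k}" if "i \<in> {1..k}" for i
    using that private_idx_subset[of i k n] by (simp add: N_def)
  \<comment> \<open>With \<open>ns = 0\<close> the shared index interval is empty, which leaves only
    the private block.\<close>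
  have p_eq: "p i = real_cond_exp M (sigma_gen M (ef_base E) (private_idx n i) X) (indicat_real Y)" for i
    by (simp add: p_def forecast_def cond_prob_one_def shared_idx_def no_shared
        Y_eq[unfolded y_def no_shared])
  have expert: "AE \<omega> in M. \<tau>1 + t i \<omega> \<in> D (n i) \<and> p i \<omega> = F (n i) (\<tau>1 + t i \<omega>)"
    if i: "i \<in> {1..k}" for i
  proof -
    have IJ: "private_idx n i \<subseteq> J" and lI: "l \<notin> private_idx n i"
      using sub[OF i] NJ l(2) by auto
    have card: "card (private_idx n i) = n i" using i by (simp add: card_private_idx)
    show ?thesis
      using AE_posterior_finite[OF IJ] cond_prob_sample[OF IJ l(1) lI A]
      unfolding p_eq card Y_def[symmetric]
      by eventually_elim (simp add: D_def pgf_dom_iff F_def t_def suff_stat_def)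
  qed
  have experts_AE: "AE \<omega> in M. \<forall>i\<in>{1..k}. \<tau>1 + t i \<omega> \<in> D (n i) \<and> p i \<omega> = F (n i) (\<tau>1 + t i \<omega>)"
    using expert by (intro AE_finite_allI) auto

  \<comment> \<open>Prediction from the pooled data\<close>
  let ?H = "sigma_gen M (ef_base E) {1..N k} X"
  let ?P = "sigma_gen M borel {1..k} p" and ?T = "sigma_gen M borel {1..k} t"
  have H: "subalgebra M ?H" by (rule subalgebra_sample[OF NJ])
  have sum_t: "(\<Sum>i=1..k. t i \<omega>) = (\<Sum>j=1..N k. ef_h E (X j \<omega>))" for \<omega>
    unfolding t_def suff_stat_def N_def by (rule sum_private_idx)
  have pooled: "AE \<omega> in M. \<tau>1 + (\<Sum>i=1..k. t i \<omega>) \<in> D (N k)"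
    unfolding sum_t using AE_posterior_finite[OF NJ] by (simp add: D_def pgf_dom_iff)
  have cond_H: "AE \<omega> in M. real_cond_exp M ?H (indicat_real Y) \<omega> = F (N k) (\<tau>1 + (\<Sum>i=1..k. t i \<omega>))"
    unfolding sum_t using cond_prob_sample[OF NJ l A] by (simp add: Y_def F_def)

  have X_H: "X j \<in> measurable ?H (ef_base E)" if "j \<in> {1..N k}" for j
    using measurable_sample_sigma_gen[OF NJ that] .
  have t_H: "t i \<in> borel_measurable ?H" if i: "i \<in> {1..k}" for i
    unfolding t_def suff_stat_def
    using sub[OF i] by (intro borel_measurable_sum measurable_compose[OF X_H]) auto
  \<comment> \<open>Each forecast is a version of a conditional expectation given a
    sub-sigma-algebra of \<open>?H\<close>, hence measurable there outright and not merely up to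
    null sets.\<close>
  have p_H: "p i \<in> borel_measurable ?H" if i: "i \<in> {1..k}" for i
    unfolding p_eq
  proof (rule measurable_from_subalg[OF _ borel_measurable_cond_exp])
    show "subalgebra ?H (sigma_gen M (ef_base E) (private_idx n i) X)"
      using sub[OF i] X_H by (intro subalgebra_sigma_gen) auto
  qed
  have P: "subalgebra ?H ?P" and T: "subalgebra ?H ?T"
    using p_H t_H by (auto intro: subalgebra_sigma_gen)
  have p_P [measurable]: "p i \<in> borel_measurable ?P" and t_T [measurable]: "t i \<in> borel_measurable ?T"
    if "i \<in> {1..k}" for i
    using that by (auto intro: measurable_sigma_gen)

  \<comment> \<open>Each inverted forecast \<open>\<tau>1 + t i \<omega>\<close> carries its own
    copy of the prior hyperparameter. The pooled predictor needs one copy out of \<open>k\<close>,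
    so \<open>k - 1\<close> are subtracted.\<close>
  have pred_sum: "(1 - real k) * \<tau>1 + (\<Sum>i=1..k. \<tau>1 + t i \<omega>) = \<tau>1 + (\<Sum>i=1..k. t i \<omega>)" for \<omega>
    by (simp add: sum.distrib algebra_simps)
  have Finv_p0: "- (real k - 1) * Finv 0 p0 = (1 - real k) * \<tau>1"
    by (simp add: p0 Finv_F[OF \<tau>1])
  have Finv_p: "AE \<omega> in M. - (real k - 1) * Finv 0 p0 + (\<Sum>i=1..k. Finv (n i) (p i \<omega>)) =
      \<tau>1 + (\<Sum>i=1..k. t i \<omega>)"
    unfolding Finv_p0 pred_sum[symmetric] using experts_AE
    by eventually_elim (auto simp: Finv_F intro!: sum.cong)
  have G_p: "AE \<omega> in M. (1 - real k) * \<tau>1 + (\<Sum>i=1..k. G (n i) (p i \<omega>)) =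
      \<tau>1 + (\<Sum>i=1..k. t i \<omega>)"
    unfolding pred_sum[symmetric] using experts_AE
    by eventually_elim (auto simp: G intro!: sum.cong)

  \<comment> \<open>Coarsening demands a \<open>?P\<close>-measurable predictor, so it is carried
    out with the Borel inverses \<open>G\<close>; \<open>Finv\<close> replaces them afterwards,
    since both recover the same value almost surely.\<close>
  have "AE \<omega> in M. real_cond_exp M ?P (indicat_real Y) \<omega> =
      F (N k) ((1 - real k) * \<tau>1 + (\<Sum>i=1..k. G (n i) (p i \<omega>)))"
  proof (rule real_cond_exp_coarsen[OF H P Y_int])
    show "AE \<omega> in M. real_cond_exp M ?H (indicat_real Y) \<omega> =
        F (N k) ((1 - real k) * \<tau>1 + (\<Sum>i=1..k. G (n i) (p i \<omega>)))"
      using cond_H G_p by eventually_elim simp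
  qed measurable
  with G_p Finv_p have cond_P: "AE \<omega> in M. real_cond_exp M ?P (indicat_real Y) \<omega> =
      F (N k) (- (real k - 1) * Finv 0 p0 + (\<Sum>i=1..k. Finv (n i) (p i \<omega>)))"
    by eventually_elim simp
  \<comment> \<open>Here the predictor is a Borel function of the conditioning statistics as it
    stands.\<close>
  have cond_T: "AE \<omega> in M. real_cond_exp M ?T (indicat_real Y) \<omega> = F (N k) (\<tau>1 + (\<Sum>i=1..k. t i \<omega>))"
    by (rule real_cond_exp_coarsen[OF H T Y_int cond_H]) measurable

  \<comment> \<open>The additive and linear models\<close>
  have y_meas: "y \<in> borel_measurable M"
    using Y measurable_cong[of M y "indicat_real Y" borel] y_eq by simp
  \<comment> \<open>The models condition \<open>y\<close> itself, the computations above the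
    indicator of \<open>Y\<close>; the two agree on \<open>space M\<close>.\<close>
  have real_cond_exp_y: "AE \<omega> in M. real_cond_exp M S y \<omega> = real_cond_exp M S (indicat_real Y) \<omega>"
    if S: "subalgebra ?H S" for S
  proof -
    have "subalgebra M S" using H S by (auto simp: subalgebra_def)
    then interpret S: finite_measure_subalgebra M S by unfold_locales
    show ?thesis using y_meas y_eq by (intro S.real_cond_exp_cong) auto
  qed
  have p_M: "\<forall>i\<in>{1..k}. p i \<in> borel_measurable M" and t_M: "\<forall>i\<in>{1..k}. t i \<in> borel_measurable M"
    by (blast intro: measurable_from_subalg[OF H] p_H t_H)+
  have gam: "generalized_additive_model M y {1..k} p (D (N k)) (F (N k))
      (- (real k - 1) * Finv 0 p0) (\<lambda>i. Finv (n i))"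
    unfolding generalized_additive_model_def
    using inj p_M
  proof (intro conjI)
    \<comment> \<open>Almost surely the additive predictor equals the pooled hyperparameter, which
      lies in the set where \<open>F (N k)\<close> is injective.\<close>
    show "AE \<omega> in M. - (real k - 1) * Finv 0 p0 + (\<Sum>i\<in>{1..k}. Finv (n i) (p i \<omega>)) \<in> D (N k) \<and>
        real_cond_exp M ?P y \<omega> = F (N k) (- (real k - 1) * Finv 0 p0 + (\<Sum>i\<in>{1..k}. Finv (n i) (p i \<omega>)))"
      using pooled Finv_p cond_P real_cond_exp_y[OF P] by eventually_elim simp
  qed
  have glm: "generalized_linear_model M y {1..k} t (D (N k)) (F (N k)) \<tau>1 (\<lambda>i s. s)"
    unfolding generalized_linear_model_def generalized_additive_model_def
    using inj t_M
  proof (intro conjI)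
    show "AE \<omega> in M. \<tau>1 + (\<Sum>i\<in>{1..k}. t i \<omega>) \<in> D (N k) \<and>
        real_cond_exp M ?T y \<omega> = F (N k) (\<tau>1 + (\<Sum>i\<in>{1..k}. t i \<omega>))"
      using pooled cond_T real_cond_exp_y[OF T] by eventually_elim simp
  qed (auto simp: linear_ident)
  show ?thesis
    unfolding cond_prob_one_def Y_eq
    using \<tau>1 p0 expert cond_P cond_T gam glm by blast
qed

end
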